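(* Let $\mathcal{H}$ and $\mathcal{K}$ be Hilbert spaces, let $B:\mathcal{H}\to\mathcal{K}$ be a bounded linear operator with closed range, and let $A_1\in L(\mathcal{H})^+$ and $A_2\in L(\mathcal{K})^+$. If $(A_1,N(B))$ and $(A_2,R(B))$ are compatible pairs, then $$GI(B,A_1,A_2)=\{(I-Q)B^{\dagger}P:\ Q\in P(A_1,N(B)),\ P\in P(A_2,R(B))\},$$ where $B^{\dagger}$ is the Moore-Penrose inverse of $B$.
   Context: Hilbert spaces are complex. $L(\mathcal{H},\mathcal{K})$ is the space of bounded linear operators, $L(\mathcal{H})=L(\mathcal{H},\mathcal{H})$, and $L(\mathcal{H})^+$ is the cone of positive semidefinite operators in $L(\mathcal{H})$. $R(\cdot)$ and $N(\cdot)$ denote range and nullspace. $CR(\mathcal{K},\mathcal{H})$ is the set of operators in $L(\mathcal{K},\mathcal{H})$ with closed range. For $A\in L(\mathcal{H})^+$ and a closed subspace $\mathcal{S}\subseteq\mathcal{H}$, define $P(A,\mathcal{S})=\{Q\in L(\mathcal{H}):Q^2=Q,\ R(Q)=\mathcal{S},\ AQ=Q^*A\}$; the pair $(A,\mathcal{S})$ is called compatible if $P(A,\mathcal{S})\neq\emptyset$. $GI(B,A_1,A_2)$ is the set of all $C\in CR(\mathcal{K},\mathcal{H})$ such that $BCB=B$, $CBC=C$, $A_1CB=B^*C^*A_1$ and $A_2BC=C^*B^*A_2$. The Moore-Penrose inverse $B^{\dagger}\in L(\mathcal{K},\mathcal{H})$ of the closed range operator $B$ is the operator with $B^{\dagger}Bx=x$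 for $x\in N(B)^{\perp}$ and $B^{\dagger}y=0$ for $y\in R(B)^{\perp}$. *)

theory Defs
  imports "HOL-Analysis.Analysis"
begin

class complex_inner = real_normed_vector +
  fixes scaleC :: "complex \<Rightarrow> 'a \<Rightarrow> 'a"  (infixr \<open>*\<^sub>C\<close> 75)
    and cinner :: "'a \<Rightarrow> 'a \<Rightarrow> complex"
  assumes scaleC_add_right: "a *\<^sub>C (x + y) = a *\<^sub>C x + a *\<^sub>C y"
    and scaleC_add_left: "(a + b) *\<^sub>C x = a *\<^sub>C x + b *\<^sub>C x"
    and scaleC_scaleC: "a *\<^sub>C (b *\<^sub>C x) = (a * b) *\<^sub>C x"
    and scaleR_scaleC: "scaleR r x = complex_of_real r *\<^sub>C x"
    and cinner_commute: "cinner x y = cnj (cinner y x)"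
    and cinner_add_left: "cinner (x + y) z = cinner x z + cinner y z"
    and cinner_scaleC_left: "cinner (a *\<^sub>C x) y = a * cinner x y"
    and cinner_self: "cinner x x = complex_of_real ((norm x)\<^sup>2)"

text \<open>
  The inner product is linear in its first argument.  The law \<open>1 *\<^sub>C x = x\<close> follows from
  \<open>scaleR_scaleC\<close>, and positive definiteness follows from \<open>cinner_self\<close>, which also says
  that the norm is the one induced by the inner product.
\<close>

class chilbert_space = complex_inner + complete_space

instantiation complex :: chilbert_space
begin

definition scaleC_complex_def: "scaleC (a::complex) (x::complex) = a * x"
definition cinner_complex_def: "cinner (x::complex) (y::complex) = x * cnj y"

instance
  by standard
    (simp_all add: scaleC_complex_def cinner_complex_def algebra_simps scaleR_conv_of_real
      complex_mult_cnj cmod_power2)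

end

text \<open>
  Operators are represented by functions; products of operators are compositions, \<open>id\<close> is the
  identity operator, and \<open>id - Q\<close> is the pointwise difference.
\<close>

definition bounded_ops :: "('a::complex_inner \<Rightarrow> 'b::complex_inner) set" where
  "bounded_ops = {T. bounded_linear T \<and> (\<forall>c x. T (c *\<^sub>C x) = c *\<^sub>C T x)}"

definition positive_ops :: "('a::complex_inner \<Rightarrow> 'a) set" where
  "positive_ops = {A \<in> bounded_ops. \<forall>x. cinner (A x) x \<in> \<real>\<^sub>\<ge>\<^sub>0}"

definition closed_range_ops :: "('a::complex_inner \<Rightarrow> 'b::complex_inner) set" where
  "closed_range_ops = {T \<in> bounded_ops. closed (range T)}"

definition nullspace :: "('a \<Rightarrow> 'b::zero) \<Rightarrow> 'a set" where
  "nullspace T = {x. T x = 0}"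

definition ortho_compl :: "'a::complex_inner set \<Rightarrow> 'a set" where
  "ortho_compl S = {x. \<forall>y\<in>S. cinner x y = 0}"

text \<open>
  The descriptions below denote an operator for \<open>T \<in> bounded_ops\<close> and for
  \<open>B \<in> closed_range_ops\<close> respectively; outside these sets they are unspecified.
\<close>

definition adj :: "('a::chilbert_space \<Rightarrow> 'b::chilbert_space) \<Rightarrow> 'b \<Rightarrow> 'a" where
  "adj T = (THE T'. T' \<in> bounded_ops \<and> (\<forall>x y. cinner (T x) y = cinner x (T' y)))"

definition mp_inverse :: "('a::chilbert_space \<Rightarrow> 'b::chilbert_space) \<Rightarrow> 'b \<Rightarrow> 'a" where
  "mp_inverse B = (THE X. X \<in> bounded_ops \<and>
     (\<forall>x \<in> ortho_compl (nullspace B). X (B x) = x) \<and>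
     (\<forall>y \<in> ortho_compl (range B). X y = 0))"

definition compat_projections ::
    "('a::chilbert_space \<Rightarrow> 'a) \<Rightarrow> 'a set \<Rightarrow> ('a \<Rightarrow> 'a) set" where
  "compat_projections A S =
     {Q \<in> bounded_ops. Q \<circ> Q = Q \<and> range Q = S \<and> A \<circ> Q = adj Q \<circ> A}"

definition compatible :: "('a::chilbert_space \<Rightarrow> 'a) \<Rightarrow> 'a set \<Rightarrow> bool" where
  "compatible A S \<longleftrightarrow> compat_projections A S \<noteq> {}"

definition GI :: "('h::chilbert_space \<Rightarrow> 'k::chilbert_space) \<Rightarrow> ('h \<Rightarrow> 'h) \<Rightarrow> ('k \<Rightarrow> 'k)
    \<Rightarrow> ('k \<Rightarrow> 'h) set" where
  "GI B A1 A2 =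
     {C \<in> closed_range_ops.
        B \<circ> C \<circ> B = B \<and> C \<circ> B \<circ> C = C \<and>
        A1 \<circ> C \<circ> B = adj B \<circ> adj C \<circ> A1 \<and>
        A2 \<circ> B \<circ> C = adj C \<circ> adj B \<circ> A2}"

end

theory Submission
  imports Defs
begin

text \<open>
  If \<open>C\<close> is a weighted generalized inverse, then \<open>Q = I - CB\<close> and \<open>P = BC\<close> are compatible
  projections and \<open>(I - Q) B\<^sup>\<dagger> P = C B B\<^sup>\<dagger> B C = CBC = C\<close>.  Conversely, for \<open>C = (I - Q) B\<^sup>\<dagger> P\<close> one
  computes \<open>BC = P\<close> and \<open>CB = I - Q\<close>, and all the required identities follow; the range of \<open>C\<close> is
  closed because it is the nullspace of \<open>Q\<close>.  The only analytic input is the boundedness of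
  \<open>B\<^sup>\<dagger>\<close>, which needs Baire's theorem.
\<close>

section \<open>Complex inner product spaces\<close>

lemma norm_sq_cinner: "(norm x)\<^sup>2 = Re (cinner x x)"
  for x :: "'a::complex_inner"
  by (simp add: cinner_self)

lemma cinner_add_right: "cinner x (y + z) = cinner x y + cinner x z"
  for x :: "'a::complex_inner"
  by (metis cinner_add_left cinner_commute complex_cnj_add)

lemma cinner_scaleC_right: "cinner x (a *\<^sub>C y) = cnj a * cinner x y"
  for x :: "'a::complex_inner"
  by (metis cinner_scaleC_left cinner_commute complex_cnj_mult)

lemma cinner_zero_left [simp]: "cinner 0 x = 0"
  for x :: "'a::complex_inner"
  by (metis add_cancel_right_right cinner_add_left)

lemma cinner_diff_left: "cinner (x - y) z = cinner x z - cinner y z"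
  for x :: "'a::complex_inner"
  by (metis cinner_add_left diff_add_cancel add_diff_cancel_right')

lemma cinner_diff_right: "cinner x (y - z) = cinner x y - cinner x z"
  for x :: "'a::complex_inner"
  by (metis cinner_add_right diff_add_cancel add_diff_cancel_right')

lemma cinner_eq_zero_commute: "cinner x y = 0 \<longleftrightarrow> cinner y x = 0"
  for x :: "'a::complex_inner"
  by (metis cinner_commute complex_cnj_zero_iff)

lemma cinner_self_eq_zero [simp]: "cinner x x = 0 \<longleftrightarrow> x = 0"
  for x :: "'a::complex_inner"
  by (simp add: cinner_self)

lemma norm_scaleC: "norm (a *\<^sub>C x) = cmod a * norm x"
  for x :: "'a::complex_inner"
proof -
  have "cinner (a *\<^sub>C x) (a *\<^sub>C x) = a * cnj a * cinner x x"
    by (simp add: cinner_scaleC_left cinner_scaleC_right)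
  then have "(norm (a *\<^sub>C x))\<^sup>2 = Re (a * cnj a * cinner x x)"
    by (simp only: norm_sq_cinner)
  also have "\<dots> = (cmod a * norm x)\<^sup>2"
    by (simp add: cinner_self complex_norm_square[symmetric] power_mult_distrib
        flip: of_real_power of_real_mult)
  finally show ?thesis
    by (simp add: power2_eq_iff_nonneg)
qed

text \<open>Pythagoras: the subtracted vector is the projection of \<open>x\<close> onto the line
  spanned by \<open>y\<close>, so the remainder is orthogonal to \<open>y\<close>. The identity
  yields Cauchy-Schwarz, and also the orthogonality of a shortest vector.\<close>

lemma norm_diff_component_sq:
  fixes x y :: "'a::complex_inner"
  assumes "y \<noteq> 0"
  shows "(norm (x - (cinner x y / (norm y)\<^sup>2) *\<^sub>C y))\<^sup>2
    = (norm x)\<^sup>2 - (cmod (cinner x y))\<^sup>2 / (norm y)\<^sup>2"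
proof -
  define a where "a = cinner x y / (norm y)\<^sup>2"
  have n: "(of_real (norm y) :: complex) \<noteq> 0"
    using assms by simp
  have "cinner (x - a *\<^sub>C y) y = 0"
    using n by (simp add: cinner_diff_left cinner_scaleC_left a_def cinner_self)
  then have "cinner (x - a *\<^sub>C y) (x - a *\<^sub>C y) = cinner (x - a *\<^sub>C y) x"
    by (simp add: cinner_diff_right[of "x - a *\<^sub>C y"] cinner_scaleC_right)
  also have "\<dots> = (norm x)\<^sup>2 - cinner x y * cnj (cinner x y) / (norm y)\<^sup>2"
    by (simp add: cinner_diff_left cinner_scaleC_left cinner_self a_def flip: cinner_commute)
  also have "\<dots> = of_real ((norm x)\<^sup>2 - (cmod (cinner x y))\<^sup>2 / (norm y)\<^sup>2)"
    by (simp add: complex_norm_square[symmetric])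
  finally show ?thesis
    by (simp add: norm_sq_cinner a_def)
qed

lemma cauchy_schwarz: "cmod (cinner x y) \<le> norm x * norm y"
  for x :: "'a::complex_inner"
proof (cases "y = 0")
  case True
  then show ?thesis
    using cinner_eq_zero_commute[of x 0] by simp
next
  case False
  have "0 \<le> (norm x)\<^sup>2 - (cmod (cinner x y))\<^sup>2 / (norm y)\<^sup>2"
    using norm_diff_component_sq[OF False, of x] by (metis zero_le_power2)
  then have "(cmod (cinner x y))\<^sup>2 \<le> (norm x * norm y)\<^sup>2"
    using False by (simp add: field_simps power_mult_distrib)
  then show ?thesis
    by (simp add: power2_le_iff_abs_le)
qed

lemma bounded_bilinear_cinner: "bounded_bilinear (cinner :: 'a::complex_inner \<Rightarrow> _)"
proof
  show "\<exists>K. \<forall>a b :: 'a. norm (cinner a b) \<le> norm a * norm b * K"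
    by (rule exI[of _ 1]) (simp add: cauchy_schwarz)
qed (simp_all add: cinner_add_left cinner_add_right scaleR_scaleC cinner_scaleC_left
    cinner_scaleC_right scaleC_complex_def)

lemma bounded_linear_scaleC: "bounded_linear (\<lambda>x :: 'a::complex_inner. c *\<^sub>C x)"
  by (rule bounded_linear_intro[where K = "cmod c"])
    (simp_all add: scaleC_add_right scaleR_scaleC scaleC_scaleC norm_scaleC mult.commute)

lemma cinner_ext:
  fixes x y :: "'a::complex_inner"
  assumes "\<And>z. cinner z x = cinner z y"
  shows "x = y"
proof -
  have "cinner (x - y) (x - y) = 0"
    using assms[of "x - y"] by (simp add: cinner_diff_right[of "x - y"])
  then show ?thesis by simp
qed

lemma parallelogram:
  fixes x y :: "'a::complex_inner"
  shows "(norm (x + y))\<^sup>2 + (norm (x - y))\<^sup>2 = 2 * (norm x)\<^sup>2 + 2 * (norm y)\<^sup>2"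
  by (simp add: norm_sq_cinner cinner_add_left cinner_add_right cinner_diff_left cinner_diff_right)

section \<open>Orthogonal decomposition\<close>

text \<open>\<open>subspace\<close> asks for closure under real scalars; here complex multiples are
  required, because the component of a vector along \<open>y\<close> has a complex
  coefficient.\<close>

definition csubspace :: "'a::complex_inner set \<Rightarrow> bool" where
  "csubspace S \<longleftrightarrow> 0 \<in> S \<and> (\<forall>x\<in>S. \<forall>y\<in>S. x + y \<in> S) \<and> (\<forall>c. \<forall>x\<in>S. c *\<^sub>C x \<in> S)"

lemma csubspace_imp_subspace: "csubspace S \<Longrightarrow> subspace S"
  by (simp add: csubspace_def subspace_def scaleR_scaleC)

lemma ortho_compl_csubspace: "csubspace (ortho_compl S)"
  by (simp add: csubspace_def ortho_compl_def cinner_add_left cinner_scaleC_left)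

lemma csubspace_closure:
  fixes S :: "'a::complex_inner set"
  assumes "csubspace S"
  shows "csubspace (closure S)"
proof -
  have "c *\<^sub>C x \<in> closure S" if "x \<in> closure S" for c x
  proof -
    have "continuous_on (closure S) (\<lambda>x. c *\<^sub>C x)"
      by (rule linear_continuous_on[OF bounded_linear_scaleC])
    then have "(\<lambda>x. c *\<^sub>C x) ` closure S \<subseteq> closure S"
      using assms
      by (intro image_closure_subset) (auto simp: csubspace_def intro: closure_subset[THEN subsetD])
    with that show ?thesis by blast
  qed
  moreover have "x + y \<in> closure S" if "x \<in> closure S" "y \<in> closure S" for x y
  proof -
    \<comment> \<open>Addition is one continuous map on pairs, and the closure of a product is the
      product of the closures.\<close>
    have "(\<lambda>p. fst p + snd p) ` closure (S \<times> S) \<subseteq> closure S"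
      using assms
      by (intro image_closure_subset continuous_intros)
        (auto simp: csubspace_def intro: closure_subset[THEN subsetD])
    then show ?thesis
      using that by (force simp: closure_Times)
  qed
  ultimately show ?thesis
    using assms closure_subset[of S] by (auto simp: csubspace_def)
qed

lemma closed_ortho_compl: "closed (ortho_compl S)"
proof -
  have eq: "ortho_compl S = (\<Inter>y\<in>S. {x. cinner x y = 0})"
    by (auto simp: ortho_compl_def)
  have "closed {x. cinner x y = 0}" for y :: 'a
    by (intro closed_Collect_eq continuous_intros linear_continuous_on
        bounded_bilinear.bounded_linear_left[OF bounded_bilinear_cinner])
  then show ?thesis
    unfolding eq by (intro closed_INT) blast
qed

text \<open>Subtracting from \<open>u\<close> its component along some \<open>y\<close> in
  \<open>S\<close> would strictly shorten \<open>u\<close> unless \<open>cinner u y\<close>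
  vanishes.\<close>

lemma closest_point_imp_orthogonal:
  fixes u :: "'a::complex_inner"
  assumes "csubspace S" and min: "\<And>s. s \<in> S \<Longrightarrow> norm u \<le> norm (u - s)"
  shows "u \<in> ortho_compl S"
proof -
  have "cinner u y = 0" if y: "y \<in> S" for y
  proof (cases "y = 0")
    case False
    have "norm u \<le> norm (u - (cinner u y / (norm y)\<^sup>2) *\<^sub>C y)"
      using assms y by (intro min) (auto simp: csubspace_def)
    then have "(norm u)\<^sup>2 \<le> (norm u)\<^sup>2 - (cmod (cinner u y))\<^sup>2 / (norm y)\<^sup>2"
      unfolding norm_diff_component_sq[OF False, symmetric] by (intro power_mono) auto
    then show ?thesis
      using False by (simp add: divide_le_0_iff)
  qed (use cinner_eq_zero_commute[of u 0] in simp)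
  then show ?thesis by (simp add: ortho_compl_def)
qed

text \<open>A minimizing sequence is Cauchy by the parallelogram law; completeness gives its limit
  and closedness keeps that limit in \<open>S\<close>.\<close>

lemma closest_point_exists_subspace:
  fixes S :: "'a::chilbert_space set"
  assumes S: "csubspace S" and "closed S"
  obtains s where "s \<in> S" and "\<And>t. t \<in> S \<Longrightarrow> norm (x - s) \<le> norm (x - t)"
proof -
  define d where "d = infdist x S"
  have ne: "S \<noteq> {}" using S by (auto simp: csubspace_def)
  have d: "d \<le> norm (x - t)" if "t \<in> S" for t
    using infdist_le[OF that, of x] by (simp add: d_def dist_norm)
  have d0: "0 \<le> d" by (simp add: d_def infdist_nonneg)
  have "\<exists>t\<in>S. norm (x - t) < d + 1 / Suc n" for n
  proof (rule ccontr)
    assume "\<not> ?thesis"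
    then have "d + 1 / Suc n \<le> dist x t" if "t \<in> S" for t
      using that by (auto simp: dist_norm not_less)
    then have "d + 1 / Suc n \<le> (INF t\<in>S. dist x t)"
      using ne by (intro cINF_greatest)
    then have "d + 1 / Suc n \<le> d"
      using ne by (simp add: d_def infdist_def)
    then show False by simp
  qed
  then obtain f where fS: "f n \<in> S" and f: "norm (x - f n) < d + 1 / Suc n" for n
    by metis
  have lim: "(\<lambda>n. norm (x - f n)) \<longlonglongrightarrow> d"
  proof (rule tendsto_sandwich[of "\<lambda>_. d" _ _ "\<lambda>n. d + 1 / Suc n"])
    show "(\<lambda>n. d + 1 / Suc n) \<longlonglongrightarrow> d"
      using tendsto_add[OF tendsto_const LIMSEQ_Suc[OF lim_1_over_n[where 'a=real]], of d] by simp
    show "\<forall>\<^sub>F n in sequentially. norm (x - f n) \<le> d + 1 / Suc n"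
      by (rule always_eventually) (use f less_imp_le in blast)
  qed (use d fS in auto)
  \<comment> \<open>The midpoint of \<open>f m\<close> and \<open>f n\<close> lies in
    \<open>S\<close>, so its distance from \<open>x\<close> is at least \<open>d\<close>. This
    bounds the sum term of the parallelogram law from below and hence the difference term from
    above.\<close>
  have est: "(norm (f m - f n))\<^sup>2
      \<le> 2 * ((norm (x - f m))\<^sup>2 - d\<^sup>2) + 2 * ((norm (x - f n))\<^sup>2 - d\<^sup>2)" for m n
  proof -
    have "(1/2) *\<^sub>R (f m + f n) \<in> S"
      using csubspace_imp_subspace[OF S] fS by (intro subspace_scale subspace_add)
    then have "2 * d \<le> 2 * norm (x - (1/2) *\<^sub>R (f m + f n))"
      using d by simp
    also have "\<dots> = norm (2 *\<^sub>R (x - (1/2) *\<^sub>R (f m + f n)))"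
      by simp
    also have "2 *\<^sub>R (x - (1/2) *\<^sub>R (f m + f n)) = (x - f m) + (x - f n)"
      by (simp add: algebra_simps scaleR_2)
    finally have "(2 * d)\<^sup>2 \<le> (norm ((x - f m) + (x - f n)))\<^sup>2"
      using d0 by (intro power_mono) auto
    then show ?thesis
      using parallelogram[of "x - f m" "x - f n"] by (simp add: norm_minus_commute)
  qed
  have "Cauchy f"
  proof (rule metric_CauchyI)
    fix e :: real assume e: "0 < e"
    have "(\<lambda>n. (norm (x - f n))\<^sup>2 - d\<^sup>2) \<longlonglongrightarrow> d\<^sup>2 - d\<^sup>2"
      by (intro tendsto_intros lim)
    \<comment> \<open>With excess below \<open>e\<^sup>2 / 4\<close> at both indices, the two
      doubled terms of \<open>est\<close> add up to less than \<open>e\<^sup>2\<close>.\<close>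
    then have "\<forall>\<^sub>F n in sequentially. (norm (x - f n))\<^sup>2 - d\<^sup>2 < e\<^sup>2 / 4"
      using e by (intro order_tendstoD(2)) auto
    then obtain N where N: "\<And>n. n \<ge> N \<Longrightarrow> (norm (x - f n))\<^sup>2 - d\<^sup>2 < e\<^sup>2 / 4"
      by (auto simp: eventually_sequentially)
    have "dist (f m) (f n) < e" if "m \<ge> N" "n \<ge> N" for m n
    proof -
      have "(norm (f m - f n))\<^sup>2 < e\<^sup>2"
        using est[of m n] add_strict_mono[OF N[OF that(1)] N[OF that(2)]] by simp
      then show ?thesis
        using e by (simp add: dist_norm power_less_imp_less_base)
    qed
    then show "\<exists>M. \<forall>m\<ge>M. \<forall>n\<ge>M. dist (f m) (f n) < e" by blast
  qed
  then obtain s where s: "f \<longlonglongrightarrow> s"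
    using Cauchy_convergent_iff convergent_def by blast
  have "norm (x - s) = d"
    by (rule LIMSEQ_unique[OF _ lim]) (intro tendsto_intros s)
  moreover have "s \<in> S"
    using closed_sequentially[OF \<open>closed S\<close>] fS s by blast
  ultimately show thesis
    using that d by blast
qed

theorem orthogonal_decomposition:
  fixes S :: "'a::chilbert_space set"
  assumes S: "csubspace S" and "closed S"
  obtains s t where "s \<in> S" "t \<in> ortho_compl S" "x = s + t"
proof -
  obtain s where s: "s \<in> S" and min: "\<And>t. t \<in> S \<Longrightarrow> norm (x - s) \<le> norm (x - t)"
    using closest_point_exists_subspace[OF assms, of x] by blast
  have "x - s \<in> ortho_compl S"
  proof (rule closest_point_imp_orthogonal[OF S])
    fix t assume "t \<in> S"
    then have "s + t \<in> S" using S s by (simp add: csubspace_def)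
    then show "norm (x - s) \<le> norm (x - s - t)"
      using min[of "s + t"] by (simp add: diff_diff_eq)
  qed
  then show thesis using that s by simp
qed

section \<open>Adjoints\<close>

lemma bounded_opsI:
  assumes "\<And>x y. T (x + y) = T x + T y" "\<And>c x. T (c *\<^sub>C x) = c *\<^sub>C T x"
    "\<And>x. norm (T x) \<le> norm x * K"
  shows "T \<in> bounded_ops"
  unfolding bounded_ops_def using assms by (auto intro!: bounded_linear_intro simp: scaleR_scaleC)

lemma bounded_ops_linear: "T \<in> bounded_ops \<Longrightarrow> bounded_linear T"
  by (simp add: bounded_ops_def)

lemma bounded_ops_scaleC: "T \<in> bounded_ops \<Longrightarrow> T (c *\<^sub>C x) = c *\<^sub>C T x"
  by (simp add: bounded_ops_def)

lemmas bounded_ops_add = bounded_ops_linear[THEN bounded_linear.linear, THEN linear_add]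
  and bounded_ops_diff = bounded_ops_linear[THEN bounded_linear.linear, THEN linear_diff]
  and bounded_ops_zero = bounded_ops_linear[THEN bounded_linear.linear, THEN linear_0]

lemma bounded_ops_comp: "S \<in> bounded_ops \<Longrightarrow> T \<in> bounded_ops \<Longrightarrow> S \<circ> T \<in> bounded_ops"
  by (simp add: bounded_ops_def bounded_linear_compose o_def)

lemma bounded_ops_id: "id \<in> bounded_ops"
  by (simp add: bounded_ops_def id_def bounded_linear_ident)

lemma scaleC_diff_right: "c *\<^sub>C (x - y) = c *\<^sub>C x - c *\<^sub>C y"
  for x :: "'a::complex_inner"
  by (rule linear_diff[OF bounded_linear.linear[OF bounded_linear_scaleC]])

lemma bounded_ops_minus: "S \<in> bounded_ops \<Longrightarrow> T \<in> bounded_ops \<Longrightarrow> S - T \<in> bounded_ops"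
  by (simp add: bounded_ops_def fun_diff_def bounded_linear_sub scaleC_diff_right)

lemma csubspace_nullspace: "T \<in> bounded_ops \<Longrightarrow> csubspace (nullspace T)"
  by (simp add: csubspace_def nullspace_def bounded_ops_zero bounded_ops_add bounded_ops_scaleC
      linear_0[OF bounded_linear.linear[OF bounded_linear_scaleC]])

lemma closed_nullspace: "T \<in> bounded_ops \<Longrightarrow> closed (nullspace T)"
  unfolding nullspace_def
  by (intro closed_Collect_eq continuous_intros linear_continuous_on bounded_ops_linear)

lemma csubspace_image:
  assumes T: "T \<in> bounded_ops" and S: "csubspace S"
  shows "csubspace (T ` S)"
  unfolding csubspace_def
proof (intro conjI ballI allI)
  show "0 \<in> T ` S"
    using S by (intro image_eqI[of _ _ 0]) (simp_all add: bounded_ops_zero[OF T] csubspace_def)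
  show "u + v \<in> T ` S" if "u \<in> T ` S" "v \<in> T ` S" for u v
    using that S by (auto simp: csubspace_def simp flip: bounded_ops_add[OF T])
  show "c *\<^sub>C u \<in> T ` S" if "u \<in> T ` S" for c u
    using that S by (auto simp: csubspace_def simp flip: bounded_ops_scaleC[OF T])
qed

lemma csubspace_range: "T \<in> bounded_ops \<Longrightarrow> csubspace (range T)"
  by (rule csubspace_image) (auto simp: csubspace_def)

section \<open>Riesz representation and existence of adjoints\<close>

text \<open>A nonzero functional does not vanish on some \<open>t\<close> orthogonal to its
  nullspace. Every \<open>x\<close> differs from a multiple of \<open>t\<close> by a vector of the
  nullspace, so \<open>f x\<close> can be read off from \<open>cinner x t\<close>.\<close>

theorem riesz_representation:
  fixes f :: "'a::chilbert_space \<Rightarrow> complex"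
  assumes f: "f \<in> bounded_ops"
  obtains z where "\<And>x. f x = cinner x z"
proof (cases "\<forall>x. f x = 0")
  case True
  then have "f x = cinner x 0" for x
    using cinner_eq_zero_commute[of x 0] by simp
  then show thesis by (rule that)
next
  case False
  then obtain w where w: "f w \<noteq> 0" by blast
  obtain s t where st: "s \<in> nullspace f" "t \<in> ortho_compl (nullspace f)" "w = s + t"
    using orthogonal_decomposition[OF csubspace_nullspace closed_nullspace, OF f f] by blast
  have ft: "f t \<noteq> 0"
    using w st bounded_ops_add[OF f, of s t] by (simp add: nullspace_def)
  then have "t \<noteq> 0" using bounded_ops_zero[OF f] by blast
  then have n: "complex_of_real (norm t) \<noteq> 0" by simp
  \<comment> \<open>The coefficient is conjugated because the inner product is conjugate-linear in
    its second argument; it is forced by the value at \<open>t\<close>.\<close>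
  have "f x = cinner x ((cnj (f t) / (norm t)\<^sup>2) *\<^sub>C t)" for x
  proof -
    have "f (x - (f x / f t) *\<^sub>C t) = 0"
      using ft by (simp add: bounded_ops_diff[OF f] bounded_ops_scaleC[OF f] scaleC_complex_def)
    then have "cinner t (x - (f x / f t) *\<^sub>C t) = 0"
      using st by (simp add: ortho_compl_def nullspace_def)
    then have "cinner x t = (f x / f t) * (norm t)\<^sup>2"
      using cinner_eq_zero_commute[of t "x - (f x / f t) *\<^sub>C t"]
      by (simp add: cinner_diff_left cinner_scaleC_left cinner_self)
    then show ?thesis
      using ft n by (simp add: cinner_scaleC_right)
  qed
  then show thesis using that by blast
qed

text \<open>Riesz represents each functional \<open>\<lambda>x. cinner (T x) y\<close>. Linearity of
  the resulting map follows because a vector is determined by its inner products.\<close>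

lemma adj_exists:
  fixes T :: "'a::chilbert_space \<Rightarrow> 'b::chilbert_space"
  assumes T: "T \<in> bounded_ops"
  shows "\<exists>T'. T' \<in> bounded_ops \<and> (\<forall>x y. cinner (T x) y = cinner x (T' y))"
proof -
  obtain K where K: "\<And>x. norm (T x) \<le> norm x * K" and K0: "0 < K"
    using bounded_linear.pos_bounded[OF bounded_ops_linear[OF T]] by blast
  have "\<exists>z. \<forall>x. cinner (T x) y = cinner x z" for y
  proof -
    have "(\<lambda>x. cinner (T x) y) \<in> bounded_ops"
    proof (rule bounded_opsI)
      fix x
      have "cmod (cinner (T x) y) \<le> norm (T x) * norm y" by (rule cauchy_schwarz)
      also have "\<dots> \<le> norm x * K * norm y" by (intro mult_right_mono K) simp
      finally show "cmod (cinner (T x) y) \<le> norm x * (K * norm y)" by (simp add: mult.assoc)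
    qed (simp_all add: T bounded_ops_add bounded_ops_scaleC cinner_add_left cinner_scaleC_left
        scaleC_complex_def)
    then show ?thesis using riesz_representation by metis
  qed
  then obtain T' where T': "\<And>x y. cinner (T x) y = cinner x (T' y)"
    by metis
  have "T' \<in> bounded_ops"
  proof (rule bounded_opsI)
    show "T' (x + y) = T' x + T' y" for x y
      by (rule cinner_ext) (simp add: cinner_add_right flip: T')
    show "T' (c *\<^sub>C x) = c *\<^sub>C T' x" for c x
      by (rule cinner_ext) (simp add: cinner_scaleC_right flip: T')
    fix y
    \<comment> \<open>Taking \<open>T' y\<close> itself as the test vector gives a bound in which
      one factor \<open>norm (T' y)\<close> cancels.\<close>
    have "(norm (T' y))\<^sup>2 = cmod (cinner (T (T' y)) y)"
      by (simp add: T' cinner_self norm_power)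
    also have "\<dots> \<le> norm (T (T' y)) * norm y" by (rule cauchy_schwarz)
    also have "\<dots> \<le> norm (T' y) * K * norm y" by (intro mult_right_mono K) simp
    finally have "norm (T' y) * norm (T' y) \<le> norm (T' y) * (norm y * K)"
      by (simp add: power2_eq_square mult_ac)
    then show "norm (T' y) \<le> norm y * K"
      using K0 by (cases "T' y = 0") auto
  qed
  with T' show ?thesis by blast
qed

text \<open>This resolves the definite description in \<open>adj\<close>; later an adjoint is
  computed by exhibiting a candidate and checking the defining identity.\<close>

lemma adj_unique:
  fixes T :: "'a::chilbert_space \<Rightarrow> 'b::chilbert_space"
  assumes "T' \<in> bounded_ops" "\<And>x y. cinner (T x) y = cinner x (T' y)"
  shows "adj T = T'"
  unfolding adj_def
proof (rule the_equality)
  fix S assume S: "S \<in> bounded_ops \<and> (\<forall>x y. cinner (T x) y = cinner x (S y))"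
  show "S = T'"
    by (rule ext, rule cinner_ext) (metis S assms(2))
qed (use assms in blast)

lemma adj_bounded_ops: "T \<in> bounded_ops \<Longrightarrow> adj T \<in> bounded_ops"
  using adj_exists adj_unique by metis

lemma cinner_adj: "T \<in> bounded_ops \<Longrightarrow> cinner (T x) y = cinner x (adj T y)"
  using adj_exists adj_unique by metis

lemma adj_comp:
  fixes S :: "'b::chilbert_space \<Rightarrow> 'c::chilbert_space" and T :: "'a::chilbert_space \<Rightarrow> 'b"
  assumes "S \<in> bounded_ops" "T \<in> bounded_ops"
  shows "adj (S \<circ> T) = adj T \<circ> adj S"
  by (rule adj_unique) (simp_all add: assms adj_bounded_ops bounded_ops_comp cinner_adj)

lemma adj_id_minus:
  fixes T :: "'a::chilbert_space \<Rightarrow> 'a"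
  assumes "T \<in> bounded_ops"
  shows "adj (id - T) = id - adj T"
  by (rule adj_unique)
    (simp_all add: assms adj_bounded_ops bounded_ops_minus bounded_ops_id cinner_adj
      cinner_diff_left cinner_diff_right)

section \<open>The bounded inverse and the Moore--Penrose inverse\<close>

text \<open>The closed sets \<open>F n\<close> cover the space, so by Baire one of them contains a
  ball. A bound on a ball around \<open>z\<close> becomes a bound on a ball around 0 by subtracting
  the value at the centre.\<close>

theorem weakly_bounded_imp_bounded:
  fixes Y :: "'a::chilbert_space set"
  assumes wb: "\<And>z. \<exists>M. \<forall>y\<in>Y. cmod (cinner y z) \<le> M"
  shows "bounded Y"
proof -
  define F where "F n = {z :: 'a. \<forall>y\<in>Y. cmod (cinner y z) \<le> real n}" for n :: nat
  have "\<exists>n. z \<in> F n" for z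
  proof -
    obtain M where M: "\<forall>y\<in>Y. cmod (cinner y z) \<le> M" using wb by blast
    obtain n where "M \<le> real n" using real_arch_simple by blast
    then have "z \<in> F n" using M by (force simp: F_def)
    then show ?thesis ..
  qed
  then have U: "(\<Union>n. F n) = UNIV" by blast
  have cl: "closed (F n)" for n
  proof -
    have eq: "F n = (\<Inter>y\<in>Y. {z. cmod (cinner y z) \<le> real n})"
      by (auto simp: F_def)
    have "closed {z. cmod (cinner y z) \<le> real n}" for y :: 'a
      by (intro closed_Collect_le continuous_intros linear_continuous_on
          bounded_bilinear.bounded_linear_right[OF bounded_bilinear_cinner])
    then show ?thesis
      unfolding eq by (intro closed_INT) blast
  qed
  have "\<exists>n. interior (F n) \<noteq> {}"
  proof (rule ccontr)
    assume "\<not> ?thesis"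
    then have "euclidean interior_of (\<Union>(range F)) = {}"
      using cl completely_metrizable_space_euclidean
      by (intro Baire_category_alt) auto
    then show False using U by simp
  qed
  then obtain n z where "z \<in> interior (F n)" by blast
  then obtain e where e: "0 < e" "cball z e \<subseteq> F n"
    using mem_interior_cball by blast
  have "norm y \<le> 2 * real n / e" if y: "y \<in> Y" for y
  proof (cases "y = 0")
    case False
    \<comment> \<open>The multiple of \<open>y\<close> of length \<open>e\<close>:
      \<open>z + w\<close> stays in the ball, while \<open>cinner y w\<close> equals
      \<open>e * norm y\<close>.\<close>
    define w where "w = (e / norm y) *\<^sub>R y"
    have "norm w = e" using e False by (simp add: w_def)
    then have "z \<in> F n" "z + w \<in> F n"
      using e by (auto intro!: subsetD[OF e(2)] simp: dist_norm)
    then have "cmod (cinner y (z + w)) \<le> n" "cmod (cinner y z) \<le> n"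
      using y by (auto simp: F_def)
    moreover have "cinner y w = cinner y (z + w) - cinner y z"
      by (simp add: cinner_add_right)
    ultimately have "cmod (cinner y w) \<le> 2 * real n"
      using norm_triangle_ineq4[of "cinner y (z + w)" "cinner y z"] by simp
    moreover have "cinner y w = of_real (e * norm y)"
      using False
      by (simp add: w_def scaleR_scaleC cinner_scaleC_right cinner_self power2_eq_square)
    ultimately have "e * norm y \<le> 2 * real n" using e by (simp add: norm_mult)
    then show ?thesis using e by (simp add: field_simps)
  qed (use e in simp)
  then show ?thesis by (auto simp: bounded_iff)
qed

section \<open>Bounded inverse by duality\<close>

text \<open>The vectors \<open>y\<close> of the range with \<open>norm (adj B y) \<le> 1\<close>
  form a weakly bounded set: since the range is closed, any \<open>z\<close> splits as
  \<open>B x\<close> plus a part orthogonal to the range, and \<open>cinner y (B x)\<close> has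
  modulus at most \<open>norm x\<close>. Uniform boundedness and rescaling give the
  constant.\<close>

lemma adj_bounded_below_on_range:
  fixes B :: "'a::chilbert_space \<Rightarrow> 'b::chilbert_space"
  assumes "B \<in> closed_range_ops"
  obtains c where "0 < c" "\<And>y. y \<in> range B \<Longrightarrow> norm y \<le> c * norm (adj B y)"
proof -
  have B: "B \<in> bounded_ops" and cl: "closed (range B)"
    using assms by (auto simp: closed_range_ops_def)
  define Y where "Y = {y \<in> range B. norm (adj B y) \<le> 1}"
  have "\<exists>M. \<forall>y\<in>Y. cmod (cinner y z) \<le> M" for z
  proof -
    obtain s t where st: "s \<in> range B" "t \<in> ortho_compl (range B)" "z = s + t"
      using orthogonal_decomposition[OF csubspace_range[OF B] cl] by blast
    then obtain x where x: "s = B x" by blast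
    have "cmod (cinner y z) \<le> norm x" if "y \<in> Y" for y
    proof -
      have "cinner y t = 0"
        using st(2) that cinner_eq_zero_commute[of y t] by (auto simp: ortho_compl_def Y_def)
      then have "cinner y z = cnj (cinner (B x) y)"
        by (simp add: st(3) x cinner_add_right flip: cinner_commute)
      then have "cmod (cinner y z) = cmod (cinner x (adj B y))"
        by (simp add: cinner_adj[OF B])
      also have "\<dots> \<le> norm x * norm (adj B y)" by (rule cauchy_schwarz)
      also have "\<dots> \<le> norm x * 1" using that by (intro mult_left_mono) (auto simp: Y_def)
      finally show ?thesis by simp
    qed
    then show ?thesis by blast
  qed
  then have "bounded Y" by (rule weakly_bounded_imp_bounded)
  then obtain c where c: "0 < c" "\<And>y. y \<in> Y \<Longrightarrow> norm y \<le> c"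
    by (auto simp: bounded_pos)
  have sub: "subspace (range B)"
    by (rule csubspace_imp_subspace[OF csubspace_range[OF B]])
  have lin: "linear (adj B)"
    using adj_bounded_ops[OF B] bounded_ops_linear bounded_linear.linear by blast
  have "norm y \<le> c * norm (adj B y)" if y: "y \<in> range B" for y
  proof (cases "adj B y = 0")
    case True
    \<comment> \<open>Here \<open>y\<close> lies in the range of \<open>B\<close> and in the kernel
      of \<open>adj B\<close>, which is orthogonal to that range, so \<open>y\<close> is
      zero.\<close>
    obtain x where "y = B x" using y by blast
    then have "cinner y y = 0"
      using cinner_adj[OF B, of x y] True cinner_eq_zero_commute[of x 0] by simp
    then show ?thesis using c by simp
  next
    case False
    then have "(1 / norm (adj B y)) *\<^sub>R y \<in> Y"
      using y subspace_scale[OF sub] linear_scale[OF lin] by (simp add: Y_def)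
    from c(2)[OF this] show ?thesis using False by (simp add: field_simps)
  qed
  with c(1) that show thesis by blast
qed

text \<open>The part \<open>t\<close> of \<open>x\<close> orthogonal to the closure is shown to lie
  both in the nullspace of \<open>B\<close> and in its orthogonal complement. The image is taken of
  \<open>range B\<close> because that is where the lower bound for \<open>adj B\<close> is
  available.\<close>

lemma ortho_compl_nullspace_subset_closure:
  fixes B :: "'a::chilbert_space \<Rightarrow> 'b::chilbert_space"
  assumes B: "B \<in> bounded_ops"
  shows "ortho_compl (nullspace B) \<subseteq> closure (adj B ` range B)"
proof
  fix x assume x: "x \<in> ortho_compl (nullspace B)"
  let ?M = "closure (adj B ` range B)"
  have M: "csubspace ?M"
    by (intro csubspace_closure csubspace_image adj_bounded_ops B csubspace_range)
  obtain m t where mt: "m \<in> ?M" "t \<in> ortho_compl ?M" "x = m + t"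
    by (rule orthogonal_decomposition[OF M closed_closure])
  have "adj B ` range B \<subseteq> ortho_compl (nullspace B)"
  proof -
    have "cinner (adj B y) z = 0" if "B z = 0" for y z
      using cinner_adj[OF B, of z y] that cinner_eq_zero_commute[of z "adj B y"] by simp
    then show ?thesis by (auto simp: ortho_compl_def nullspace_def)
  qed
  then have "?M \<subseteq> ortho_compl (nullspace B)"
    by (rule closure_minimal[OF _ closed_ortho_compl])
  then have "m \<in> ortho_compl (nullspace B)" using mt by blast
  then have tN: "t \<in> ortho_compl (nullspace B)"
    using x mt(3) by (simp add: ortho_compl_def cinner_add_left)
  \<comment> \<open>Orthogonality of \<open>t\<close> to \<open>adj B (B t)\<close> says that
    \<open>B t\<close> has norm zero.\<close>
  have "adj B (B t) \<in> ?M"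
    by (intro subsetD[OF closure_subset] imageI rangeI)
  then have "cinner (B t) (B t) = 0"
    using mt(2) cinner_adj[OF B, of t "B t"] by (simp add: ortho_compl_def)
  then have "B t = 0" by simp
  then have "cinner t t = 0"
    using tN by (simp add: ortho_compl_def nullspace_def)
  then show "x \<in> ?M" using mt by simp
qed

text \<open>
  The bounded inverse theorem is obtained by duality: the uniform boundedness principle gives
  \<open>norm y \<le> c * norm (adj B y)\<close> on the range of \<open>B\<close>, and
  \<open>(norm (adj B y))\<^sup>2 = cinner (B (adj B y)) y\<close> transfers this bound to \<open>B\<close> itself.
\<close>

theorem closed_range_imp_bounded_below:
  fixes B :: "'a::chilbert_space \<Rightarrow> 'b::chilbert_space"
  assumes "B \<in> closed_range_ops"
  obtains c where "0 < c" "\<And>x. x \<in> ortho_compl (nullspace B) \<Longrightarrow> norm x \<le> c * norm (B x)"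
proof -
  have B: "B \<in> bounded_ops"
    using assms by (auto simp: closed_range_ops_def)
  obtain c where c: "0 < c" "\<And>y. y \<in> range B \<Longrightarrow> norm y \<le> c * norm (adj B y)"
    using adj_bounded_below_on_range[OF assms] by blast
  \<comment> \<open>The desired estimate is a closed condition, so it passes from the image of
    \<open>range B\<close> under \<open>adj B\<close> to the closure, with the same constant
    \<open>c\<close>.\<close>
  define F where "F = {x. norm x \<le> c * norm (B x)}"
  have "closed F"
    unfolding F_def
    by (intro closed_Collect_le continuous_intros linear_continuous_on bounded_ops_linear B)
  moreover have "adj B ` range B \<subseteq> F"
  proof -
    have "norm (adj B y) \<le> c * norm (B (adj B y))" if "y \<in> range B" for y
    proof -
      have "(norm (adj B y))\<^sup>2 = cmod (cinner (B (adj B y)) y)"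
        by (simp add: cinner_adj[OF B] cinner_self norm_power)
      also have "\<dots> \<le> norm (B (adj B y)) * norm y" by (rule cauchy_schwarz)
      also have "\<dots> \<le> norm (B (adj B y)) * (c * norm (adj B y))"
        by (intro mult_left_mono c that) simp
      finally have "norm (adj B y) * norm (adj B y) \<le> (c * norm (B (adj B y))) * norm (adj B y)"
        by (simp add: power2_eq_square mult_ac)
      then show ?thesis using c by (cases "adj B y = 0") auto
    qed
    then show ?thesis by (auto simp: F_def)
  qed
  ultimately have "closure (adj B ` range B) \<subseteq> F"
    by (rule closure_minimal[rotated])
  then have "ortho_compl (nullspace B) \<subseteq> F"
    using ortho_compl_nullspace_subset_closure[OF B] by blast
  then show thesis using that[OF c(1)] by (auto simp: F_def)
qed

section \<open>Construction of the Moore-Penrose inverse\<close>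

lemma norm_le_norm_add_orthogonal:
  fixes s t :: "'a::complex_inner"
  assumes "cinner t s = 0"
  shows "norm s \<le> norm (s + t)"
proof -
  have "(norm s)\<^sup>2 \<le> (norm (s + t))\<^sup>2"
    using assms cinner_eq_zero_commute[of t s]
    by (simp add: norm_sq_cinner[of "s + t"] cinner_add_left cinner_add_right) (simp add: cinner_self)
  then show ?thesis by simp
qed

text \<open>Two orthogonal splittings: \<open>y\<close> is split along the closed range, then a
  preimage of its range part is split along the nullspace, whose contribution \<open>B\<close>
  kills.\<close>

lemma mp_inverse_decomposition:
  fixes B :: "'a::chilbert_space \<Rightarrow> 'b::chilbert_space"
  assumes "B \<in> closed_range_ops"
  obtains x t where "x \<in> ortho_compl (nullspace B)" "t \<in> ortho_compl (range B)" "y = B x + t"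
proof -
  have B: "B \<in> bounded_ops" and cl: "closed (range B)"
    using assms by (auto simp: closed_range_ops_def)
  obtain s t where st: "s \<in> range B" "t \<in> ortho_compl (range B)" "y = s + t"
    using orthogonal_decomposition[OF csubspace_range[OF B] cl] by blast
  then obtain w where w: "s = B w" by blast
  obtain u x where ux: "u \<in> nullspace B" "x \<in> ortho_compl (nullspace B)" "w = u + x"
    using orthogonal_decomposition[OF csubspace_nullspace closed_nullspace, OF B B] by blast
  then have "s = B x" using w by (simp add: bounded_ops_add[OF B] nullspace_def)
  then show thesis using that ux st by blast
qed

text \<open>\<open>X y\<close> is the least-squares solution orthogonal to the nullspace. Its
  uniqueness gives linearity and both defining identities; the lower bound for \<open>B\<close>
  gives boundedness.\<close>

lemma mp_inverse_exists:
  fixes B :: "'a::chilbert_space \<Rightarrow> 'b::chilbert_space"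
  assumes cr: "B \<in> closed_range_ops"
  obtains X where "X \<in> bounded_ops" "\<And>x. x \<in> ortho_compl (nullspace B) \<Longrightarrow> X (B x) = x"
    "\<And>y. y \<in> ortho_compl (range B) \<Longrightarrow> X y = 0"
proof -
  let ?M = "ortho_compl (nullspace B)" and ?R = "ortho_compl (range B)"
  have B: "B \<in> bounded_ops"
    using assms by (auto simp: closed_range_ops_def)
  obtain c where c: "0 < c" "\<And>x. x \<in> ?M \<Longrightarrow> norm x \<le> c * norm (B x)"
    using closed_range_imp_bounded_below[OF cr] by blast
  have M: "csubspace ?M" and R: "csubspace ?R" by (rule ortho_compl_csubspace)+
  have "\<exists>x. x \<in> ?M \<and> y - B x \<in> ?R" for y
    using mp_inverse_decomposition[OF cr, of y] by (metis add_diff_cancel_left')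
  then obtain X where X: "\<And>y. X y \<in> ?M" "\<And>y. y - B (X y) \<in> ?R"
    by metis
  have uniq: "X y = x" if "x \<in> ?M" "y - B x \<in> ?R" for x y
  proof -
    have d: "X y - x \<in> ?M"
      using csubspace_imp_subspace[OF M] X that by (intro subspace_diff)
    have "(y - B x) - (y - B (X y)) \<in> ?R"
      by (rule subspace_diff[OF csubspace_imp_subspace[OF R] that(2) X(2)])
    \<comment> \<open>This vector is in the range and orthogonal to it, hence zero; the lower bound
      for \<open>B\<close> then forces \<open>X y = x\<close>.\<close>
    then have "B (X y - x) \<in> ?R"
      by (simp add: bounded_ops_diff[OF B])
    then have "cinner (B (X y - x)) (B (X y - x)) = 0"
      unfolding ortho_compl_def by blast
    then have "norm (X y - x) \<le> 0"
      using c(2)[OF d] by simp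
    then show ?thesis by simp
  qed
  have "X \<in> bounded_ops"
  proof (rule bounded_opsI)
    fix y z
    have "(y - B (X y)) + (z - B (X z)) \<in> ?R"
      using R X by (simp add: csubspace_def)
    then show "X (y + z) = X y + X z"
      using M X by (intro uniq) (simp_all add: csubspace_def bounded_ops_add[OF B] algebra_simps)
  next
    fix a y
    have "a *\<^sub>C (y - B (X y)) \<in> ?R"
      using R X by (simp add: csubspace_def)
    then show "X (a *\<^sub>C y) = a *\<^sub>C X y"
      using M X by (intro uniq)
        (simp_all add: csubspace_def bounded_ops_scaleC[OF B] scaleC_diff_right)
  next
    fix y
    \<comment> \<open>\<open>B (X y)\<close> is the orthogonal projection of \<open>y\<close> onto
      the range, so its norm is at most \<open>norm y\<close>.\<close>
    have "norm (B (X y)) \<le> norm (B (X y) + (y - B (X y)))"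
      using X(2)[of y] by (intro norm_le_norm_add_orthogonal) (auto simp: ortho_compl_def)
    then have "c * norm (B (X y)) \<le> c * norm y"
      using c by (intro mult_left_mono) auto
    then show "norm (X y) \<le> norm y * c"
      using c(2)[OF X(1)[of y]] by (simp add: mult.commute)
  qed
  moreover have "X (B x) = x" if "x \<in> ?M" for x
    using that R by (intro uniq) (auto simp: csubspace_def)
  moreover have "X y = 0" if "y \<in> ?R" for y
    using that M by (intro uniq) (auto simp: csubspace_def bounded_ops_zero[OF B])
  ultimately show thesis using that by blast
qed

text \<open>The defining conditions fix an operator on each \<open>B x + t\<close> of the
  decomposition, hence everywhere, so the description in \<open>mp_inverse\<close> denotes the
  operator constructed above.\<close>

theorem mp_inverse:
  fixes B :: "'a::chilbert_space \<Rightarrow> 'b::chilbert_space"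
  assumes cr: "B \<in> closed_range_ops"
  shows mp_inverse_bounded_ops: "mp_inverse B \<in> bounded_ops"
    and mp_inverse_left: "x \<in> ortho_compl (nullspace B) \<Longrightarrow> mp_inverse B (B x) = x"
proof -
  obtain X where X: "X \<in> bounded_ops" "\<And>x. x \<in> ortho_compl (nullspace B) \<Longrightarrow> X (B x) = x"
    "\<And>y. y \<in> ortho_compl (range B) \<Longrightarrow> X y = 0"
    using mp_inverse_exists[OF cr] by blast
  have "mp_inverse B = X"
    unfolding mp_inverse_def
  proof (rule the_equality)
    fix Z assume Z: "Z \<in> bounded_ops \<and> (\<forall>x \<in> ortho_compl (nullspace B). Z (B x) = x) \<and>
      (\<forall>y \<in> ortho_compl (range B). Z y = 0)"
    show "Z = X"
    proof
      fix y
      obtain x t where "x \<in> ortho_compl (nullspace B)" "t \<in> ortho_compl (range B)" "y = B x + t"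
        using mp_inverse_decomposition[OF cr, of y] by blast
      then show "Z y = X y"
        using X Z by (simp add: bounded_ops_add)
    qed
  qed (use X in blast)
  with X show "mp_inverse B \<in> bounded_ops"
    and "x \<in> ortho_compl (nullspace B) \<Longrightarrow> mp_inverse B (B x) = x"
    by auto
qed

text \<open>Replacing \<open>w\<close> by its component orthogonal to the nullspace leaves
  \<open>B w\<close> unchanged. Through this identity \<open>mp_inverse B\<close> enters the final
  computation.\<close>

lemma mp_inverse_inner:
  fixes B :: "'a::chilbert_space \<Rightarrow> 'b::chilbert_space"
  assumes cr: "B \<in> closed_range_ops"
  shows "B (mp_inverse B (B w)) = B w"
proof -
  have B: "B \<in> bounded_ops"
    using assms by (auto simp: closed_range_ops_def)
  obtain u x where ux: "u \<in> nullspace B" "x \<in> ortho_compl (nullspace B)" "w = u + x"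
    using orthogonal_decomposition[OF csubspace_nullspace closed_nullspace, OF B B] by blast
  then have "B w = B x" by (simp add: bounded_ops_add[OF B] nullspace_def)
  then show ?thesis using mp_inverse_left[OF cr ux(2)] by simp
qed

section \<open>Weighted generalized inverses\<close>

theorem theorem3p7:
  fixes B :: "'h::chilbert_space \<Rightarrow> 'k::chilbert_space"
    and A1 :: "'h \<Rightarrow> 'h"
    and A2 :: "'k \<Rightarrow> 'k"
  assumes "B \<in> closed_range_ops"
    and "A1 \<in> positive_ops"
    and "A2 \<in> positive_ops"
    and "compatible A1 (nullspace B)"
    and "compatible A2 (range B)"
  shows "GI B A1 A2 =
    {(id - Q) \<circ> mp_inverse B \<circ> P | Q P.
       Q \<in> compat_projections A1 (nullspace B) \<and> P \<in> compat_projections A2 (range B)}"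
proof (intro set_eqI iffI)
  have B: "B \<in> bounded_ops"
    using assms by (auto simp: closed_range_ops_def)
  have A1: "A1 \<in> bounded_ops"
    using assms by (auto simp: positive_ops_def)
  have Bp: "mp_inverse B \<in> bounded_ops"
    by (rule mp_inverse_bounded_ops[OF assms(1)])
  note BB = mp_inverse_inner[OF assms(1)]
  {
    fix C assume "C \<in> GI B A1 A2"
    then have C: "C \<in> bounded_ops" and BCB: "\<And>x. B (C (B x)) = B x"
      and CBC: "\<And>y. C (B (C y)) = C y"
      and e1: "A1 \<circ> C \<circ> B = adj B \<circ> adj C \<circ> A1" and e2: "A2 \<circ> B \<circ> C = adj C \<circ> adj B \<circ> A2"
      by (auto simp: GI_def closed_range_ops_def fun_eq_iff)
    define Q where "Q = id - (C \<circ> B)"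
    define P where "P = B \<circ> C"
    have "range Q = nullspace B"
    proof (intro set_eqI iffI)
      fix x assume "x \<in> nullspace B"
      then have "x = Q x" by (simp add: Q_def nullspace_def bounded_ops_zero[OF C])
      then show "x \<in> range Q" by (rule range_eqI)
    qed (auto simp: Q_def nullspace_def bounded_ops_diff[OF B] BCB)
    moreover have "A1 \<circ> Q = adj Q \<circ> A1"
      \<comment> \<open>The weighted symmetry of \<open>C \<circ> B\<close> passes to its complement
        \<open>Q\<close>, since \<open>A1\<close> commutes with subtraction and \<open>adj Q\<close>
        is the identity minus \<open>adj B \<circ> adj C\<close>.\<close>
      using e1 by (simp add: Q_def fun_eq_iff adj_id_minus adj_comp bounded_ops_comp B C
          bounded_ops_diff[OF A1])
    moreover have "Q \<circ> Q = Q"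
      by (simp add: Q_def fun_eq_iff bounded_ops_diff[OF B] bounded_ops_diff[OF C] BCB CBC
          bounded_ops_zero[OF C])
    moreover have "Q \<in> bounded_ops"
      by (simp add: Q_def bounded_ops_minus bounded_ops_comp bounded_ops_id B C)
    ultimately have Q: "Q \<in> compat_projections A1 (nullspace B)"
      by (simp add: compat_projections_def)
    have "range P = range B"
    proof (intro set_eqI iffI)
      fix y assume "y \<in> range B"
      then have "y = P y" by (auto simp: P_def BCB)
      then show "y \<in> range P" by (rule range_eqI)
    qed (auto simp: P_def)
    moreover have "A2 \<circ> P = adj P \<circ> A2"
      using e2 by (simp add: P_def fun_eq_iff adj_comp B C)
    moreover have "P \<circ> P = P"
      by (simp add: P_def fun_eq_iff BCB)
    moreover have "P \<in> bounded_ops"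
      by (simp add: P_def bounded_ops_comp B C)
    ultimately have P: "P \<in> compat_projections A2 (range B)"
      by (simp add: compat_projections_def)
    have "C = (id - Q) \<circ> mp_inverse B \<circ> P"
      by (simp add: Q_def P_def fun_eq_iff BB CBC)
    then show "C \<in> {(id - Q) \<circ> mp_inverse B \<circ> P | Q P.
       Q \<in> compat_projections A1 (nullspace B) \<and> P \<in> compat_projections A2 (range B)}"
      using Q P by blast
  next
    fix C assume "C \<in> {(id - Q) \<circ> mp_inverse B \<circ> P | Q P.
       Q \<in> compat_projections A1 (nullspace B) \<and> P \<in> compat_projections A2 (range B)}"
    then obtain Q P where CQP: "C = (id - Q) \<circ> mp_inverse B \<circ> P"
      and Q: "Q \<in> bounded_ops" "\<And>x. Q (Q x) = Q x" "range Q = nullspace B"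
        "A1 \<circ> Q = adj Q \<circ> A1"
      and P: "P \<in> bounded_ops" "\<And>x. P (P x) = P x" "range P = range B"
        "A2 \<circ> P = adj P \<circ> A2"
      by (auto simp: compat_projections_def fun_eq_iff)
    have C: "C \<in> bounded_ops"
      unfolding CQP by (intro bounded_ops_comp bounded_ops_minus bounded_ops_id Q P Bp)
    \<comment> \<open>The equality of \<open>range Q\<close> and \<open>nullspace B\<close> is used
      in two ways: \<open>B\<close> kills the values of \<open>Q\<close>, and the idempotent
      \<open>Q\<close> fixes the nullspace.\<close>
    have BQ: "B (Q x) = 0" for x
      using Q(3) by (auto simp: nullspace_def)
    have Qfix: "Q x = x" if "B x = 0" for x
    proof -
      have "x \<in> range Q" using that by (simp add: Q(3) nullspace_def)
      then show ?thesis using Q(2) by auto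
    qed
    have PB: "P (B x) = B x" for x
    proof -
      have "B x \<in> range P" by (simp add: P(3))
      then show ?thesis using P(2) by auto
    qed
    have BC: "B \<circ> C = P"
    proof
      \<comment> \<open>Since \<open>B\<close> kills \<open>Q\<close>, the factor
        \<open>id - Q\<close> disappears under \<open>B\<close>, and
        \<open>B \<circ> mp_inverse B\<close> fixes \<open>P y\<close> because it lies in the range
        of \<open>B\<close>.\<close>
      fix y
      have "P y \<in> range B" using P(3) by blast
      then show "(B \<circ> C) y = P y"
        by (auto simp: CQP bounded_ops_diff[OF B] BQ BB)
    qed
    have CB: "C \<circ> B = id - Q"
    proof
      fix x
      \<comment> \<open>The difference is fixed by \<open>Q\<close>, so \<open>id - Q\<close>
        annihilates it and takes the same value at \<open>mp_inverse B (B x)\<close> as at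
        \<open>x\<close>.\<close>
      have "B (mp_inverse B (B x) - x) = 0"
        by (simp add: bounded_ops_diff[OF B] BB)
      from Qfix[OF this] show "(C \<circ> B) x = (id - Q) x"
        by (simp add: CQP PB bounded_ops_diff[OF Q(1)] algebra_simps)
    qed
    have CBC: "C \<circ> B \<circ> C = C"
      unfolding CB by (simp add: CQP fun_eq_iff bounded_ops_diff[OF Q(1)] Q(2))
    have BCB: "B \<circ> C \<circ> B = B"
      unfolding BC by (simp add: fun_eq_iff PB)
    \<comment> \<open>This yields the closed range. A vector killed by \<open>Q\<close> is
      reproduced by \<open>C \<circ> B = id - Q\<close>; conversely \<open>Q\<close> annihilates
      every value of \<open>id - Q\<close>.\<close>
    have "range C = nullspace Q"
    proof (intro set_eqI iffI)
      fix x assume "x \<in> nullspace Q"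
      then have "x = C (B x)" using fun_cong[OF CB, of x] by (simp add: nullspace_def)
      then show "x \<in> range C" by (rule range_eqI)
    qed (auto simp: CQP nullspace_def bounded_ops_diff[OF Q(1)] Q(2))
    then have "C \<in> closed_range_ops"
      using closed_nullspace[OF Q(1)] C by (simp add: closed_range_ops_def)
    moreover have "A1 \<circ> C \<circ> B = adj B \<circ> adj C \<circ> A1"
    proof -
      \<comment> \<open>The symmetry of \<open>Q\<close> passes to its complement
        \<open>id - Q\<close>, which is \<open>C \<circ> B\<close>.\<close>
      have "A1 \<circ> (C \<circ> B) = adj (C \<circ> B) \<circ> A1"
        unfolding CB adj_id_minus[OF Q(1)]
        using Q(4) by (simp add: fun_eq_iff bounded_ops_diff[OF A1])
      then show ?thesis by (simp add: adj_comp[OF C B] comp_assoc)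
    qed
    moreover have "A2 \<circ> B \<circ> C = adj C \<circ> adj B \<circ> A2"
    proof -
      have "A2 \<circ> (B \<circ> C) = adj (B \<circ> C) \<circ> A2"
        unfolding BC by (rule P(4))
      then show ?thesis by (simp add: adj_comp[OF B C] comp_assoc)
    qed
    ultimately show "C \<in> GI B A1 A2"
      using BCB CBC by (simp add: GI_def)
  }
qed

end
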